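(* Let $K$ be a field and let $q\in K$ be a nonzero element which is not a root of unity. Let $C=C(q)$ be the quantized Weyl algebra, and let $M$, its submodule $V$, and $W=M/V$ be the left $C$-modules defined in the context. Then: (a) $V$ is a simple $C$-module, and $M$ is a non-Artinian essential extension of its submodule $V$; (b) the submodules of $W$ are linearly ordered by inclusion, and are pairwise non-isomorphic.
   Context: The quantized Weyl algebra $C(q)$ is the $K$-algebra generated by $a,b$ subject to the relation $ab-q\,ba=1$. Let $\mathbb{N}=\{0,1,2,\dots\}$. Let $M$ be the $K$-vector space with basis $\{v_i,w_j : i,j\in\mathbb{N}\}$, and let $V=\mathrm{span}_K\{v_i: i\in\mathbb{N}\}$. The generators $a,b$ act on $M$ as the linear operators given by $$av_0=0,\qquad av_n=\frac{q^n-1}{q-1}v_{n-1}\ (n\ge 1),\qquad bv_n=v_{n+1}\ (n\ge 0),$$ $$aw_n=q^n(w_n+w_{n+1}),\qquad bw_n=\frac{q^{-n}}{1-q}w_n+(-1)^nv_0\qquad (n\ge 0).$$ These operators satisfy $ab-q\,ba=1$, so $M$ is a left $C$-module, and $V$ is a submodule of $M$. Set $W=M/V$. Modules are left modules. *)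

theory Defs
  imports
    "HOL-Algebra.Algebraic_Closure_Type"
    "HOL-Library.Poly_Mapping"
begin

section \<open>Left modules over a ring that need not be commutative\<close>

text \<open>
  The locale \<^locale>\<open>module\<close> of HOL-Algebra requires a commutative ring of scalars, so its
  axioms are repeated here over a \<^locale>\<open>ring\<close>. The record type of modules and the locale
  \<^locale>\<open>submodule\<close> make no such assumption and are used as they are. The fields
  \<^const>\<open>monoid.mult\<close> and \<^const>\<open>one\<close> of a module record carry no information and are left
  \<^const>\<open>undefined\<close>.
\<close>

locale left_module = R?: ring R + M?: abelian_group M
  for R :: "('a, 'r) ring_scheme" (structure) and M :: "('a, 'b, 'm) module_scheme" (structure) +
  assumes smult_closed:
      "\<lbrakk>a \<in> carrier R; x \<in> carrier M\<rbrakk> \<Longrightarrow> a \<odot>\<^bsub>M\<^esub> x \<in> carrier M"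
    and smult_l_distr:
      "\<lbrakk>a \<in> carrier R; b \<in> carrier R; x \<in> carrier M\<rbrakk> \<Longrightarrow>
      (a \<oplus>\<^bsub>R\<^esub> b) \<odot>\<^bsub>M\<^esub> x = a \<odot>\<^bsub>M\<^esub> x \<oplus>\<^bsub>M\<^esub> b \<odot>\<^bsub>M\<^esub> x"
    and smult_r_distr:
      "\<lbrakk>a \<in> carrier R; x \<in> carrier M; y \<in> carrier M\<rbrakk> \<Longrightarrow>
      a \<odot>\<^bsub>M\<^esub> (x \<oplus>\<^bsub>M\<^esub> y) = a \<odot>\<^bsub>M\<^esub> x \<oplus>\<^bsub>M\<^esub> a \<odot>\<^bsub>M\<^esub> y"
    and smult_assoc1:
      "\<lbrakk>a \<in> carrier R; b \<in> carrier R; x \<in> carrier M\<rbrakk> \<Longrightarrow>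
      (a \<otimes>\<^bsub>R\<^esub> b) \<odot>\<^bsub>M\<^esub> x = a \<odot>\<^bsub>M\<^esub> (b \<odot>\<^bsub>M\<^esub> x)"
    and smult_one:
      "x \<in> carrier M \<Longrightarrow> \<one>\<^bsub>R\<^esub> \<odot>\<^bsub>M\<^esub> x = x"

definition quotient_module ::
    "('a, 'r) ring_scheme \<Rightarrow> ('a, 'b, 'm) module_scheme \<Rightarrow> 'b set \<Rightarrow> ('a, 'b set) module" where
  "quotient_module R M N =
    \<lparr>carrier = a_rcosets\<^bsub>M\<^esub> N, monoid.mult = undefined, one = undefined, ring.zero = N, add = set_add M,
     module.smult = (\<lambda>r Y. \<Union>x\<in>Y. N +>\<^bsub>M\<^esub> (r \<odot>\<^bsub>M\<^esub> x))\<rparr>"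

lemma left_module_quotient_module:
  assumes "left_module R M" "submodule N R M"
  shows "left_module R (quotient_module R M N)"
proof -
  interpret left_module R M by fact
  interpret N: submodule N R M by fact
  interpret N: abelian_subgroup N M
    by (rule abelian_subgroupI3) (use N.subgroup_axioms M.abelian_group_axioms in \<open>auto intro: additive_subgroup.intro\<close>)
  let ?Q = "quotient_module R M N"
  have carrier: "Y \<in> carrier ?Q \<longleftrightarrow> (\<exists>x\<in>carrier M. Y = N +>\<^bsub>M\<^esub> x)" for Y
    by (auto simp: quotient_module_def A_RCOSETS_def RCOSETS_def a_r_coset_def)
  have add: "(N +>\<^bsub>M\<^esub> x) \<oplus>\<^bsub>?Q\<^esub> (N +>\<^bsub>M\<^esub> y) = N +>\<^bsub>M\<^esub> (x \<oplus>\<^bsub>M\<^esub> y)"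
    if "x \<in> carrier M" "y \<in> carrier M" for x y
    using N.a_rcos_sum[OF that] by (simp add: quotient_module_def)
  have smult: "r \<odot>\<^bsub>?Q\<^esub> (N +>\<^bsub>M\<^esub> x) = N +>\<^bsub>M\<^esub> (r \<odot>\<^bsub>M\<^esub> x)"
    if r: "r \<in> carrier R" and x: "x \<in> carrier M" for r x
  proof -
    have "N +>\<^bsub>M\<^esub> (r \<odot>\<^bsub>M\<^esub> y) = N +>\<^bsub>M\<^esub> (r \<odot>\<^bsub>M\<^esub> x)" if "y \<in> N +>\<^bsub>M\<^esub> x" for y
    proof -
      obtain n where n: "n \<in> N" "y = n \<oplus>\<^bsub>M\<^esub> x"
        using \<open>y \<in> _\<close> by (auto simp: a_r_coset_def r_coset_def)
      have nc: "n \<in> carrier M" using n N.a_Hcarr by blast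
      have "r \<odot>\<^bsub>M\<^esub> y = r \<odot>\<^bsub>M\<^esub> n \<oplus>\<^bsub>M\<^esub> r \<odot>\<^bsub>M\<^esub> x"
        using n r x nc by (simp add: smult_r_distr)
      then have "r \<odot>\<^bsub>M\<^esub> y \<in> N +>\<^bsub>M\<^esub> (r \<odot>\<^bsub>M\<^esub> x)"
        using n r by (auto simp: a_r_coset_def r_coset_def)
      then show ?thesis
        using N.a_repr_independence' smult_closed[OF r x] by simp
    qed
    moreover have "x \<in> N +>\<^bsub>M\<^esub> x" by (rule N.a_rcos_self[OF x])
    ultimately have "(\<Union>y\<in>N +>\<^bsub>M\<^esub> x. N +>\<^bsub>M\<^esub> (r \<odot>\<^bsub>M\<^esub> y)) = N +>\<^bsub>M\<^esub> (r \<odot>\<^bsub>M\<^esub> x)"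
      by blast
    then show ?thesis by (simp add: quotient_module_def)
  qed
  have zero: "\<zero>\<^bsub>?Q\<^esub> = N +>\<^bsub>M\<^esub> \<zero>\<^bsub>M\<^esub>"
    using M.a_coset_add_zero[OF N.a_subset] by (simp add: quotient_module_def)
  have "abelian_group ?Q"
  proof (rule abelian_groupI)
    fix Y assume "Y \<in> carrier ?Q"
    then obtain x where "x \<in> carrier M" "Y = N +>\<^bsub>M\<^esub> x" by (auto simp: carrier)
    then show "\<exists>Z\<in>carrier ?Q. Z \<oplus>\<^bsub>?Q\<^esub> Y = \<zero>\<^bsub>?Q\<^esub>"
      by (intro bexI[of _ "N +>\<^bsub>M\<^esub> (\<ominus>\<^bsub>M\<^esub> x)"]) (auto simp: add zero carrier M.l_neg)
  qed (auto simp: carrier add zero M.a_ac)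
  moreover have "left_module_axioms R ?Q"
    by unfold_locales
      (auto simp: carrier add smult smult_closed smult_l_distr smult_r_distr smult_assoc1 smult_one)
  ultimately show ?thesis
    by (intro left_module.intro R.ring_axioms)
qed

definition left_module_hom ::
    "('a, 'r) ring_scheme \<Rightarrow> ('a, 'b, 'm) module_scheme \<Rightarrow> ('a, 'c, 'n) module_scheme
      \<Rightarrow> ('b \<Rightarrow> 'c) set" where
  "left_module_hom R M N =
    {h \<in> carrier M \<rightarrow> carrier N.
      (\<forall>x\<in>carrier M. \<forall>y\<in>carrier M. h (x \<oplus>\<^bsub>M\<^esub> y) = h x \<oplus>\<^bsub>N\<^esub> h y) \<and>
      (\<forall>r\<in>carrier R. \<forall>x\<in>carrier M. h (r \<odot>\<^bsub>M\<^esub> x) = r \<odot>\<^bsub>N\<^esub> h x)}"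

definition isomorphic_modules ::
    "('a, 'r) ring_scheme \<Rightarrow> ('a, 'b, 'm) module_scheme \<Rightarrow> ('a, 'c, 'n) module_scheme \<Rightarrow> bool" where
  "isomorphic_modules R M N \<longleftrightarrow>
    (\<exists>h\<in>left_module_hom R M N. bij_betw h (carrier M) (carrier N))"

definition simple_module :: "('a, 'r) ring_scheme \<Rightarrow> ('a, 'b, 'm) module_scheme \<Rightarrow> bool" where
  "simple_module R M \<longleftrightarrow>
    left_module R M \<and> carrier M \<noteq> {\<zero>\<^bsub>M\<^esub>} \<and>
    (\<forall>N. submodule N R M \<longrightarrow> N = {\<zero>\<^bsub>M\<^esub>} \<or> N = carrier M)"

definition artinian_module :: "('a, 'r) ring_scheme \<Rightarrow> ('a, 'b, 'm) module_scheme \<Rightarrow> bool" where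
  "artinian_module R M \<longleftrightarrow>
    (\<forall>N :: nat \<Rightarrow> 'b set. (\<forall>i. submodule (N i) R M) \<and> decseq N \<longrightarrow> (\<exists>n. \<forall>m\<ge>n. N m = N n))"

definition essential_extension ::
    "('a, 'r) ring_scheme \<Rightarrow> ('a, 'b, 'm) module_scheme \<Rightarrow> 'b set \<Rightarrow> bool" where
  "essential_extension R M V \<longleftrightarrow>
    left_module R M \<and> submodule V R M \<and>
    (\<forall>N. submodule N R M \<and> N \<noteq> {\<zero>\<^bsub>M\<^esub>} \<longrightarrow> N \<inter> V \<noteq> {\<zero>\<^bsub>M\<^esub>})"


section \<open>Finitely supported functions as a vector space\<close>

definition scale :: "'k \<Rightarrow> ('b \<Rightarrow>\<^sub>0 'k) \<Rightarrow> ('b \<Rightarrow>\<^sub>0 'k::field)" where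
  "scale c x = Poly_Mapping.map ((*) c) x"

lemma lookup_scale: "Poly_Mapping.lookup (scale c x) i = c * Poly_Mapping.lookup x i"
  by (simp add: scale_def Poly_Mapping.map.rep_eq when_def)

lemma vector_space_scale: "vector_space (scale :: 'k::field \<Rightarrow> ('b \<Rightarrow>\<^sub>0 'k) \<Rightarrow> _)"
  by unfold_locales (auto intro!: poly_mapping_eqI simp: lookup_scale lookup_add algebra_simps)

global_interpretation scale: vector_space "scale :: 'k::field \<Rightarrow> ('b \<Rightarrow>\<^sub>0 'k) \<Rightarrow> _"
  by (rule vector_space_scale)

definition linear_extension :: "('b \<Rightarrow> ('c \<Rightarrow>\<^sub>0 'k)) \<Rightarrow> ('b \<Rightarrow>\<^sub>0 'k) \<Rightarrow> ('c \<Rightarrow>\<^sub>0 'k::field)" where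
  "linear_extension f x = (\<Sum>i\<in>Poly_Mapping.keys x. scale (Poly_Mapping.lookup x i) (f i))"


section \<open>The quantized Weyl algebra\<close>

text \<open>
  The free algebra on two generators is the monoid algebra of the free monoid on them.
  \<^theory>\<open>HOL-Library.Poly_Mapping\<close> expects the monoid in additive notation, hence the
  wrapper around lists whose addition is concatenation.
\<close>

datatype gen = Gen_a | Gen_b

datatype word = Word (letters: "gen list")

instantiation word :: monoid_add
begin

definition zero_word :: word where "0 = Word []"

definition plus_word :: "word \<Rightarrow> word \<Rightarrow> word" where "u + v = Word (letters u @ letters v)"

instance by standard (simp_all add: zero_word_def plus_word_def)

end

type_synonym 'k free_alg = "word \<Rightarrow>\<^sub>0 'k"

definition generator :: "gen \<Rightarrow> 'k::field free_alg" where
  "generator g = Poly_Mapping.single (Word [g]) 1"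

definition weyl_relator :: "'k::field \<Rightarrow> 'k free_alg" where
  "weyl_relator q =
    generator Gen_a * generator Gen_b - scale q (generator Gen_b * generator Gen_a) - 1"

abbreviation free_algebra :: "'k::field free_alg ring" where
  "free_algebra \<equiv> ring_of_type_algebra"

definition weyl_ideal :: "'k::field \<Rightarrow> 'k free_alg set" where
  "weyl_ideal q = Idl\<^bsub>free_algebra\<^esub> {weyl_relator q}"

definition quantized_weyl_algebra :: "'k::field \<Rightarrow> 'k free_alg set ring" where
  "quantized_weyl_algebra q = free_algebra Quot weyl_ideal q"


section \<open>The modules \<open>M\<close>, \<open>V\<close> and \<open>W\<close>\<close>

text \<open>The basis vectors \<open>v\<^sub>i\<close> and \<open>w\<^sub>j\<close> are indexed by \<open>Inl i\<close> and \<open>Inr j\<close>.\<close>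

type_synonym 'k M_space = "(nat + nat) \<Rightarrow>\<^sub>0 'k"

definition v_vec :: "nat \<Rightarrow> 'k::field M_space" where
  "v_vec i = Poly_Mapping.single (Inl i) 1"

definition w_vec :: "nat \<Rightarrow> 'k::field M_space" where
  "w_vec j = Poly_Mapping.single (Inr j) 1"

definition a_op :: "'k::field \<Rightarrow> 'k M_space \<Rightarrow> 'k M_space" where
  "a_op q = linear_extension
    (\<lambda>Inl n \<Rightarrow> (if n = 0 then 0 else scale ((q ^ n - 1) / (q - 1)) (v_vec (n - 1)))
     | Inr n \<Rightarrow> scale (q ^ n) (w_vec n + w_vec (n + 1)))"

definition b_op :: "'k::field \<Rightarrow> 'k M_space \<Rightarrow> 'k M_space" where
  "b_op q = linear_extension
    (\<lambda>Inl n \<Rightarrow> v_vec (n + 1)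
     | Inr n \<Rightarrow> scale (q powi (- int n) / (1 - q)) (w_vec n) + scale ((- 1) ^ n) (v_vec 0))"

definition gen_op :: "'k::field \<Rightarrow> gen \<Rightarrow> 'k M_space \<Rightarrow> 'k M_space" where
  "gen_op q g = (case g of Gen_a \<Rightarrow> a_op q | Gen_b \<Rightarrow> b_op q)"

definition free_action :: "'k::field \<Rightarrow> 'k free_alg \<Rightarrow> 'k M_space \<Rightarrow> 'k M_space" where
  "free_action q f x = linear_extension (\<lambda>u. foldr (gen_op q) (letters u) x) f"

text \<open>
  An element of the quantized Weyl algebra is a coset \<open>c\<close> of elements of the free algebra, which
  all act on \<open>M\<close> in the same way (see \<open>smult_weyl_M\<close> below).
\<close>

definition weyl_M :: "'k::field \<Rightarrow> ('k free_alg set, 'k M_space) module" where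
  "weyl_M q =
    \<lparr>carrier = UNIV, monoid.mult = undefined, one = undefined, ring.zero = 0, add = (+),
     module.smult = (\<lambda>c x. the_elem ((\<lambda>f. free_action q f x) ` c))\<rparr>"

definition weyl_V :: "'k::field M_space set" where
  "weyl_V = scale.span (range v_vec)"

definition weyl_W :: "'k::field \<Rightarrow> ('k free_alg set, 'k M_space set) module" where
  "weyl_W q = quotient_module (quantized_weyl_algebra q) (weyl_M q) weyl_V"


section \<open>\<open>M\<close> and \<open>W\<close> are left modules and \<open>V\<close> is a submodule of \<open>M\<close>\<close>

lemma linear_extension_superset:
  assumes "finite S" "Poly_Mapping.keys x \<subseteq> S"
  shows "linear_extension f x = (\<Sum>i\<in>S. scale (Poly_Mapping.lookup x i) (f i))"
  unfolding linear_extension_def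
  by (rule sum.mono_neutral_left) (use assms in \<open>auto simp: in_keys_iff\<close>)

lemma linear_extension_add:
  "linear_extension f (x + y) = linear_extension f x + linear_extension f y"
proof -
  let ?S = "Poly_Mapping.keys x \<union> Poly_Mapping.keys y"
  have "Poly_Mapping.keys (x + y) \<subseteq> ?S" by (rule Poly_Mapping.keys_add)
  then show ?thesis
    by (simp add: linear_extension_superset[of ?S] lookup_add scale.scale_left_distrib sum.distrib)
qed

lemma linear_extension_scale: "linear_extension f (scale c x) = scale c (linear_extension f x)"
proof -
  have "Poly_Mapping.keys (scale c x) \<subseteq> Poly_Mapping.keys x"
    by (auto simp: in_keys_iff lookup_scale)
  then show ?thesis
    by (simp add: linear_extension_superset[of "Poly_Mapping.keys x"] lookup_scale scale.scale_sum_right)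
qed

lemma linear_extension_single: "linear_extension f (Poly_Mapping.single i c) = scale c (f i)"
  by (simp add: linear_extension_def)

lemma linear_linear_extension: "Vector_Spaces.linear scale scale (linear_extension f)"
  by unfold_locales (simp_all add: linear_extension_add linear_extension_scale)

lemma single_eq_scale: "Poly_Mapping.single i c = scale c (Poly_Mapping.single i 1)"
  by (simp add: scale_def)

lemma linear_eqI:
  assumes "Vector_Spaces.linear scale scale F" "Vector_Spaces.linear scale scale G"
    and "\<And>i. F (Poly_Mapping.single i 1) = G (Poly_Mapping.single i 1)"
  shows "F x = G x"
proof -
  interpret F: Vector_Spaces.linear scale scale F by fact
  interpret G: Vector_Spaces.linear scale scale G by fact
  have e: "x = (\<Sum>i\<in>Poly_Mapping.keys x. scale (Poly_Mapping.lookup x i) (Poly_Mapping.single i 1))"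
    by (rule poly_mapping_eqI) (simp add: lookup_sum lookup_scale lookup_single when_def in_keys_iff if_distrib cong: if_cong)
  show ?thesis
    by (subst e, subst (2) e) (simp add: F.sum G.sum F.scale G.scale assms(3))
qed

lemma linear_comp:
  assumes "Vector_Spaces.linear scale scale F" "Vector_Spaces.linear scale scale G"
  shows "Vector_Spaces.linear scale scale (\<lambda>x. F (G x))"
  using Vector_Spaces.linear_compose[OF assms(2,1)] by (simp add: o_def)

lemma linear_gen_op: "Vector_Spaces.linear scale scale (gen_op q g)"
  by (cases g) (simp_all add: gen_op_def a_op_def b_op_def linear_linear_extension)

lemma linear_word_op: "Vector_Spaces.linear scale scale (\<lambda>x. foldr (gen_op q) u x)"
proof (induction u)
  case Nil
  show ?case by unfold_locales simp_all
next
  case (Cons g u)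
  from linear_comp[OF linear_gen_op this] show ?case by simp
qed

lemma free_action_add_left: "free_action q (f + g) x = free_action q f x + free_action q g x"
  by (simp add: free_action_def linear_extension_add)

lemma free_action_scale_left: "free_action q (scale c f) x = scale c (free_action q f x)"
  by (simp add: free_action_def linear_extension_scale)

lemma linear_free_action_left: "Vector_Spaces.linear scale scale (\<lambda>f. free_action q f x)"
  by unfold_locales (simp_all add: free_action_add_left free_action_scale_left)

lemma linear_free_action_right: "Vector_Spaces.linear scale scale (free_action q f)"
proof -
  have "free_action q f (x + y) = free_action q f x + free_action q f y" for x y
  proof -
    have "foldr (gen_op q) u (x + y) = foldr (gen_op q) u x + foldr (gen_op q) u y" for u
      by (rule Modules.module_hom.add) (use linear_word_op in \<open>simp add: Vector_Spaces.linear_iff_module_hom\<close>)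
    then show ?thesis
      by (simp add: free_action_def linear_extension_def scale.scale_right_distrib sum.distrib)
  qed
  moreover have "free_action q f (scale c x) = scale c (free_action q f x)" for c x
  proof -
    have "foldr (gen_op q) u (scale c x) = scale c (foldr (gen_op q) u x)" for u
      by (rule Modules.module_hom.scale) (use linear_word_op in \<open>simp add: Vector_Spaces.linear_iff_module_hom\<close>)
    then show ?thesis
      by (simp add: free_action_def linear_extension_def scale.scale_sum_right mult.commute)
  qed
  ultimately show ?thesis by unfold_locales
qed

lemma free_action_single: "free_action q (Poly_Mapping.single u 1) x = foldr (gen_op q) (letters u) x"
  by (simp add: free_action_def linear_extension_single)

lemma free_action_one: "free_action q 1 x = x"
  by (simp add: free_action_single zero_word_def flip: Poly_Mapping.single_one)

lemma free_action_generator: "free_action q (generator g) x = gen_op q g x"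
  by (simp add: generator_def free_action_single)

lemma scale_mult_left: "scale c (f :: 'k::field free_alg) * g = scale c (f * g)"
  by (simp add: scale_def mult_map_scale_conv_mult mult.assoc)

lemma scale_mult_right: "(f :: 'k::field free_alg) * scale c g = scale c (f * g)"
proof -
  have comm: "Poly_Mapping.single 0 c * f = f * Poly_Mapping.single 0 c" for f :: "'k free_alg"
  proof -
    have "Vector_Spaces.linear scale scale (\<lambda>f::'k free_alg. Poly_Mapping.single 0 c * f)"
      by unfold_locales (simp_all add: distrib_left scale_def mult_map_scale_conv_mult mult_single mult.commute flip: mult.assoc)
    moreover have "Vector_Spaces.linear scale scale (\<lambda>f::'k free_alg. f * Poly_Mapping.single 0 c)"
      by unfold_locales (simp_all add: distrib_right scale_mult_left)
    ultimately show ?thesis by (rule linear_eqI) (simp add: mult_single)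
  qed
  show ?thesis
    by (metis scale_def mult_map_scale_conv_mult comm mult.assoc)
qed

lemma free_action_mult: "free_action q (f * g) x = free_action q f (free_action q g x)"
proof -
  have l1: "Vector_Spaces.linear scale scale (\<lambda>f. free_action q (f * g) x)" for g
    by unfold_locales
      (simp_all add: distrib_right free_action_add_left scale_mult_left free_action_scale_left)
  have base: "free_action q (Poly_Mapping.single u 1 * g) x =
      free_action q (Poly_Mapping.single u 1) (free_action q g x)" for u
  proof (rule linear_eqI[of "\<lambda>g. free_action q (Poly_Mapping.single u 1 * g) x"
        "\<lambda>g. free_action q (Poly_Mapping.single u 1) (free_action q g x)"])
    show "Vector_Spaces.linear scale scale (\<lambda>g. free_action q (Poly_Mapping.single u 1 * g) x)"
      by unfold_locales
        (simp_all add: distrib_left free_action_add_left scale_mult_right free_action_scale_left)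
    show "Vector_Spaces.linear scale scale
        (\<lambda>g. free_action q (Poly_Mapping.single u 1) (free_action q g x))"
      by (rule linear_comp[OF linear_free_action_right linear_free_action_left])
  qed (simp add: mult_single free_action_single plus_word_def)
  show ?thesis
    by (rule linear_eqI[OF l1 linear_free_action_left base])
qed

lemma a_op_v: "a_op q (v_vec n) = (if n = 0 then 0 else scale ((q ^ n - 1) / (q - 1)) (v_vec (n - 1)))"
  by (simp add: a_op_def v_vec_def linear_extension_single)

lemma a_op_w: "a_op q (w_vec n) = scale (q ^ n) (w_vec n + w_vec (n + 1))"
  by (simp add: a_op_def w_vec_def linear_extension_single)

lemma b_op_v: "b_op q (v_vec n) = v_vec (n + 1)"
  by (simp add: b_op_def v_vec_def linear_extension_single)

lemma b_op_w: "b_op q (w_vec n) =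
    scale (q powi (- int n) / (1 - q)) (w_vec n) + scale ((- 1) ^ n) (v_vec 0)"
  by (simp add: b_op_def w_vec_def linear_extension_single)

lemma linear_a_op: "Vector_Spaces.linear scale scale (a_op q)"
  and linear_b_op: "Vector_Spaces.linear scale scale (b_op q)"
  by (simp_all add: a_op_def b_op_def linear_linear_extension)

lemma weyl_relation:
  assumes "q \<noteq> 0" "q \<noteq> 1"
  shows "a_op q (b_op q x) - scale q (b_op q (a_op q x)) = x"
proof -
  interpret a: Vector_Spaces.linear scale scale "a_op q" by (rule linear_a_op)
  interpret b: Vector_Spaces.linear scale scale "b_op q" by (rule linear_b_op)
  have "Vector_Spaces.linear scale scale (\<lambda>x. a_op q (b_op q x) - scale q (b_op q (a_op q x)))"
    by unfold_locales
      (simp_all add: a.add b.add a.scale b.scale scale.scale_right_distrib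
        scale.scale_right_diff_distrib mult.commute)
  moreover have "Vector_Spaces.linear scale scale (\<lambda>x :: 'a M_space. x)"
    by unfold_locales simp_all
  ultimately show ?thesis
  proof (rule linear_eqI)
    fix i :: "nat + nat"
    show "a_op q (b_op q (Poly_Mapping.single i 1)) - scale q (b_op q (a_op q (Poly_Mapping.single i 1))) =
        Poly_Mapping.single i 1"
    proof (cases i)
      case (Inl n)
      have "scale ((q ^ Suc n - 1) / (q - 1) - q * ((q ^ n - 1) / (q - 1))) (v_vec n) = v_vec n"
      proof -
        have "(q ^ Suc n - 1) / (q - 1) - q * ((q ^ n - 1) / (q - 1)) = 1"
          using assms by (simp add: divide_simps) (simp add: algebra_simps)
        then show ?thesis by simp
      qed
      then have "scale ((q ^ Suc n - 1) / (q - 1)) (v_vec n) -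
          scale q (scale ((q ^ n - 1) / (q - 1)) (v_vec n)) = v_vec n"
        by (simp only: scale.scale_left_diff_distrib scale.scale_scale)
      then show ?thesis unfolding Inl v_vec_def[symmetric]
        by (cases n) (simp_all add: a_op_v b_op_v b.scale del: power_Suc)
    next
      case (Inr n)
      then show ?thesis unfolding Inr w_vec_def[symmetric] using assms
        by (intro poly_mapping_eqI)
          (simp add: a_op_w b_op_w a_op_v a.scale b.scale a.add b.add lookup_scale lookup_add
            lookup_minus power_int_diff power_int_minus, simp add: divide_simps,
            simp add: algebra_simps)
    qed
  qed
qed

lemma ring_free_algebra: "ring (free_algebra :: 'k::field free_alg ring)"
proof -
  have "\<exists>y. x + y = 0" for x :: "'k free_alg"
    using add.right_inverse by blast
  then show ?thesis
    unfolding ring_of_type_algebra_def using add.right_inverse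
    by unfold_locales (auto simp: algebra_simps Units_def)
qed

lemma free_action_zero_right: "free_action q f 0 = 0"
  by (rule Modules.module_hom.zero)
    (use linear_free_action_right in \<open>simp add: Vector_Spaces.linear_iff_module_hom\<close>)

lemma ideal_annihilator:
  "ideal {f :: 'k::field free_alg. \<forall>x. free_action q f x = 0} free_algebra" (is "ideal ?I _")
proof (rule idealI)
  show "ring (free_algebra :: 'k free_alg ring)" by (rule ring_free_algebra)
  interpret ring "free_algebra :: 'k free_alg ring" by (rule ring_free_algebra)
  interpret L: Vector_Spaces.linear scale scale "\<lambda>f. free_action q f x" for x
    by (rule linear_free_action_left)
  have minus: "\<ominus>\<^bsub>free_algebra\<^esub> f = - f" for f :: "'k free_alg"
    by (rule minus_equality) (simp_all add: ring_of_type_algebra_def)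
  show "subgroup ?I (add_monoid free_algebra)"
  proof (rule group.subgroupI)
    show "Group.group (add_monoid (free_algebra :: 'k free_alg ring))"
      by (rule add.group_axioms)
    fix f :: "'k free_alg" assume "f \<in> ?I"
    then show "inv\<^bsub>add_monoid free_algebra\<^esub> f \<in> ?I"
      using minus[of f] by (simp add: a_inv_def L.neg)
  next
    show "?I \<noteq> {}" using L.zero by blast
  qed (auto simp: ring_of_type_algebra_def L.add)
qed (auto simp: ring_of_type_algebra_def free_action_mult free_action_zero_right)

lemma ideal_weyl_ideal: "ideal (weyl_ideal q) (free_algebra :: 'k::field free_alg ring)"
  unfolding weyl_ideal_def
  by (rule ring.genideal_ideal[OF ring_free_algebra]) (simp add: ring_of_type_algebra_def)

lemma free_action_weyl_ideal:
  assumes "q \<noteq> 0" "q \<noteq> 1" "f \<in> weyl_ideal q"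
  shows "free_action q f x = 0"
proof -
  interpret L: Vector_Spaces.linear scale scale "\<lambda>f. free_action q f x" for x
    by (rule linear_free_action_left)
  have "free_action q (weyl_relator q) x = 0" for x
    using weyl_relation[OF assms(1,2), of x]
    by (simp add: weyl_relator_def L.diff L.scale free_action_mult free_action_generator
        free_action_one gen_op_def)
  then have "weyl_ideal q \<subseteq> {f. \<forall>x. free_action q f x = 0}"
    unfolding weyl_ideal_def
    by (intro ring.genideal_minimal ring_free_algebra ideal_annihilator) auto
  with assms(3) show ?thesis by auto
qed

lemma smult_weyl_M:
  assumes "q \<noteq> 0" "q \<noteq> 1"
  shows "(weyl_ideal q +>\<^bsub>free_algebra\<^esub> f) \<odot>\<^bsub>weyl_M q\<^esub> x = free_action q f x"
proof -
  interpret L: Vector_Spaces.linear scale scale "\<lambda>f. free_action q f y" for y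
    by (rule linear_free_action_left)
  interpret I: ideal "weyl_ideal q" free_algebra by (rule ideal_weyl_ideal)
  have "(0 :: 'a free_alg) \<in> weyl_ideal q"
    using additive_subgroup.zero_closed[OF I.is_additive_subgroup] by (simp add: ring_of_type_algebra_def)
  have "(\<lambda>f. free_action q f x) ` (weyl_ideal q +>\<^bsub>free_algebra\<^esub> f) = {free_action q f x}"
    using free_action_weyl_ideal[OF assms] \<open>0 \<in> weyl_ideal q\<close>
    by (force simp: a_r_coset_def r_coset_def ring_of_type_algebra_def L.add)
  then show ?thesis by (simp add: weyl_M_def)
qed

lemma weyl_algebra_cosets:
  "c \<in> carrier (quantized_weyl_algebra q) \<longleftrightarrow> (\<exists>f. c = weyl_ideal q +>\<^bsub>free_algebra\<^esub> f)"
  by (auto simp: quantized_weyl_algebra_def FactRing_def A_RCOSETS_def RCOSETS_def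
      a_r_coset_def ring_of_type_algebra_def)

lemma left_module_weyl_M:
  assumes "q \<noteq> 0" "q \<noteq> 1"
  shows "left_module (quantized_weyl_algebra q) (weyl_M q)"
proof -
  interpret L: Vector_Spaces.linear scale scale "\<lambda>f. free_action q f x" for x
    by (rule linear_free_action_left)
  interpret I: ideal "weyl_ideal q" free_algebra by (rule ideal_weyl_ideal)
  have C: "quantized_weyl_algebra q = free_algebra Quot weyl_ideal q"
    by (simp add: quantized_weyl_algebra_def)
  have hom: "(+>\<^bsub>free_algebra\<^esub>) (weyl_ideal q) \<in> ring_hom free_algebra (quantized_weyl_algebra q)"
    unfolding C by (rule I.rcos_ring_hom)
  have UNIV: "f \<in> carrier free_algebra" for f :: "'a free_alg"
    by (simp add: ring_of_type_algebra_def)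
  have ring: "ring (quantized_weyl_algebra q)"
    unfolding C by (rule I.quotient_is_ring)
  have group: "abelian_group (weyl_M q)"
    by (rule abelian_groupI) (auto simp: weyl_M_def algebra_simps intro: exI[of _ "- _"])
  note smult = smult_weyl_M[OF assms]
  have free_action_add_right: "free_action q f (x + y) = free_action q f x + free_action q f y" for f x y
    by (rule Modules.module_hom.add)
      (use linear_free_action_right in \<open>simp add: Vector_Spaces.linear_iff_module_hom\<close>)
  have add: "(c \<oplus>\<^bsub>quantized_weyl_algebra q\<^esub> d) \<odot>\<^bsub>weyl_M q\<^esub> x =
      c \<odot>\<^bsub>weyl_M q\<^esub> x \<oplus>\<^bsub>weyl_M q\<^esub> d \<odot>\<^bsub>weyl_M q\<^esub> x"
    and mult: "(c \<otimes>\<^bsub>quantized_weyl_algebra q\<^esub> d) \<odot>\<^bsub>weyl_M q\<^esub> x =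
      c \<odot>\<^bsub>weyl_M q\<^esub> (d \<odot>\<^bsub>weyl_M q\<^esub> x)"
    and distr: "c \<odot>\<^bsub>weyl_M q\<^esub> (x \<oplus>\<^bsub>weyl_M q\<^esub> y) =
      c \<odot>\<^bsub>weyl_M q\<^esub> x \<oplus>\<^bsub>weyl_M q\<^esub> c \<odot>\<^bsub>weyl_M q\<^esub> y"
    if cd: "c \<in> carrier (quantized_weyl_algebra q)" "d \<in> carrier (quantized_weyl_algebra q)" for c d x y
  proof -
    obtain f g where fg: "c = weyl_ideal q +>\<^bsub>free_algebra\<^esub> f" "d = weyl_ideal q +>\<^bsub>free_algebra\<^esub> g"
      using cd by (auto simp: weyl_algebra_cosets)
    have "c \<oplus>\<^bsub>quantized_weyl_algebra q\<^esub> d = weyl_ideal q +>\<^bsub>free_algebra\<^esub> (f + g)"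
      using ring_hom_add[OF hom UNIV UNIV, of f g] by (simp add: fg ring_of_type_algebra_def)
    then show "(c \<oplus>\<^bsub>quantized_weyl_algebra q\<^esub> d) \<odot>\<^bsub>weyl_M q\<^esub> x =
        c \<odot>\<^bsub>weyl_M q\<^esub> x \<oplus>\<^bsub>weyl_M q\<^esub> d \<odot>\<^bsub>weyl_M q\<^esub> x"
      using fg by (simp add: smult L.add) (simp add: weyl_M_def)
    have "c \<otimes>\<^bsub>quantized_weyl_algebra q\<^esub> d = weyl_ideal q +>\<^bsub>free_algebra\<^esub> (f * g)"
      using ring_hom_mult[OF hom UNIV UNIV, of f g] by (simp add: fg ring_of_type_algebra_def)
    then show "(c \<otimes>\<^bsub>quantized_weyl_algebra q\<^esub> d) \<odot>\<^bsub>weyl_M q\<^esub> x =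
        c \<odot>\<^bsub>weyl_M q\<^esub> (d \<odot>\<^bsub>weyl_M q\<^esub> x)"
      using fg by (simp add: smult free_action_mult)
    show "c \<odot>\<^bsub>weyl_M q\<^esub> (x \<oplus>\<^bsub>weyl_M q\<^esub> y) =
        c \<odot>\<^bsub>weyl_M q\<^esub> x \<oplus>\<^bsub>weyl_M q\<^esub> c \<odot>\<^bsub>weyl_M q\<^esub> y"
      unfolding fg smult
      by (simp add: weyl_M_def free_action_add_right)
  qed
  have "\<one>\<^bsub>quantized_weyl_algebra q\<^esub> = weyl_ideal q +>\<^bsub>free_algebra\<^esub> 1"
    using ring_hom_one[OF hom] by (simp add: ring_of_type_algebra_def)
  then have "\<one>\<^bsub>quantized_weyl_algebra q\<^esub> \<odot>\<^bsub>weyl_M q\<^esub> x = x" for x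
    by (simp add: smult free_action_one)
  with ring group add mult distr show ?thesis
    by (auto intro!: left_module.intro left_module_axioms.intro) (simp_all add: weyl_M_def)
qed


lemma gen_op_weyl_V:
  assumes "x \<in> weyl_V" shows "gen_op q g x \<in> weyl_V"
proof -
  interpret G: Vector_Spaces.linear scale scale "gen_op q g" by (rule linear_gen_op)
  have "gen_op q g (v_vec n) \<in> weyl_V" for n
    by (cases g) (auto simp: gen_op_def a_op_v b_op_v weyl_V_def
        intro: scale.span_scale scale.span_base scale.span_zero)
  then have "scale.span (gen_op q g ` range v_vec) \<subseteq> weyl_V"
    unfolding weyl_V_def by (intro scale.span_minimal) auto
  then show ?thesis
    using assms by (auto simp: weyl_V_def G.span_image)
qed

lemma free_action_weyl_V:
  assumes "x \<in> weyl_V" shows "free_action q f x \<in> weyl_V"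
proof -
  have "foldr (gen_op q) u x \<in> weyl_V" for u
    by (induction u) (simp_all add: assms gen_op_weyl_V)
  then show ?thesis
    unfolding free_action_def linear_extension_def weyl_V_def
    by (intro scale.span_sum scale.span_scale) auto
qed

lemma submodule_weyl_V:
  assumes "q \<noteq> 0" "q \<noteq> 1"
  shows "submodule weyl_V (quantized_weyl_algebra q) (weyl_M q)"
proof -
  interpret M: left_module "quantized_weyl_algebra q" "weyl_M q"
    by (rule left_module_weyl_M[OF assms])
  have minus: "\<ominus>\<^bsub>weyl_M q\<^esub> x = - x" for x
    by (rule M.minus_equality) (simp_all add: weyl_M_def)
  have "subgroup weyl_V (add_monoid (weyl_M q))"
  proof (rule M.add.subgroupI)
    show "weyl_V \<noteq> {}" using scale.span_zero by (auto simp: weyl_V_def)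
  qed (auto simp: weyl_M_def weyl_V_def minus[unfolded weyl_M_def] scale.span_neg scale.span_add)
  then show ?thesis
    by (intro submodule.intro submodule_axioms.intro)
      (auto simp: weyl_algebra_cosets smult_weyl_M[OF assms] free_action_weyl_V)
qed

lemma left_module_weyl_W:
  assumes "q \<noteq> 0" "q \<noteq> 1"
  shows "left_module (quantized_weyl_algebra q) (weyl_W q)"
  unfolding weyl_W_def
  by (intro left_module_quotient_module left_module_weyl_M submodule_weyl_V assms)

end

theory Submission
  imports Defs
begin

text \<open>
  Applying \<open>a\<close> lowers the degree in \<open>V\<close> and \<open>b\<close> raises it, so every nonzero submodule of \<open>V\<close>
  contains \<open>v\<^sub>0\<close> and hence everything. Modulo \<open>V\<close>, the \<open>w\<^sub>n\<close> are eigenvectors of \<open>b\<close> for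
  pairwise distinct eigenvalues \<open>\<lambda>\<^sub>n\<close>, so a submodule of \<open>M\<close> that is not contained in \<open>V\<close> contains
  some \<open>w\<^sub>n + u\<close> with \<open>u \<in> V\<close>. Then \<open>(b - \<lambda>\<^sub>n)(w\<^sub>n + u) = (-1)\<^sup>n v\<^sub>0 + (b - \<lambda>\<^sub>n) u\<close> is a nonzero
  element of \<open>V\<close>, because \<open>b - \<lambda>\<^sub>n\<close> acts on \<open>V\<close> as multiplication by a polynomial of
  degree one. In \<open>W\<close> a submodule is determined by the set of \<open>n\<close> whose \<open>w\<^sub>n\<close> it contains; this set
  is upward closed because of the action of \<open>a\<close>, and it consists of those \<open>n\<close> for which \<open>\<lambda>\<^sub>n\<close> is an
  eigenvalue of \<open>b\<close> on the submodule, so it is an isomorphism invariant.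
\<close>

section \<open>Submodules, quotients and isomorphisms of left modules\<close>

lemma left_module_submodule:
  assumes "left_module R M" "submodule N R M"
  shows "left_module R (M\<lparr>carrier := N\<rparr>)"
proof -
  interpret left_module R M by fact
  interpret N: submodule N R M by fact
  have N: "x \<in> carrier M" if "x \<in> N" for x
    using N.mem_carrier[of x] that by simp
  have "\<exists>y\<in>N. y \<oplus>\<^bsub>M\<^esub> x = \<zero>\<^bsub>M\<^esub>" if "x \<in> N" for x
    using N.m_inv_closed[OF that] M.l_neg[OF N[OF that]] by (auto simp: a_inv_def)
  moreover have "x \<oplus>\<^bsub>M\<^esub> y \<in> N" if "x \<in> N" "y \<in> N" for x y
    using N.m_closed[OF that] by simp
  moreover have "\<zero>\<^bsub>M\<^esub> \<in> N" using N.one_closed by simp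
  moreover have "x \<oplus>\<^bsub>M\<^esub> y = y \<oplus>\<^bsub>M\<^esub> x" if "x \<in> N" "y \<in> N" for x y
    using that by (intro M.a_comm N)
  moreover have "x \<oplus>\<^bsub>M\<^esub> y \<oplus>\<^bsub>M\<^esub> z = x \<oplus>\<^bsub>M\<^esub> (y \<oplus>\<^bsub>M\<^esub> z)"
    if "x \<in> N" "y \<in> N" "z \<in> N" for x y z
    using that by (intro M.a_assoc N)
  moreover have "\<zero>\<^bsub>M\<^esub> \<oplus>\<^bsub>M\<^esub> x = x" if "x \<in> N" for x
    using that by (intro M.l_zero N)
  ultimately have "abelian_group (M\<lparr>carrier := N\<rparr>)"
    by (intro abelian_groupI; clarsimp?; blast)
  moreover have "left_module_axioms R (M\<lparr>carrier := N\<rparr>)"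
    by (rule left_module_axioms.intro)
      (simp_all add: N smult_l_distr smult_r_distr smult_assoc1 smult_one)
  ultimately show ?thesis by (intro left_module.intro R.ring_axioms)
qed

text \<open>\<open>simple_module\<close> speaks of submodules of the restricted record; this moves
  them into \<open>M\<close>, where \<open>submodule_M_iff\<close> describes them.\<close>

lemma submodule_of_submodule:
  assumes "left_module R M" "submodule V R M" "submodule N R (M\<lparr>carrier := V\<rparr>)"
  shows "submodule N R M" "N \<subseteq> V"
proof -
  interpret left_module R M by fact
  interpret V: submodule V R M by fact
  interpret N: submodule N R "M\<lparr>carrier := V\<rparr>" by fact
  show NV: "N \<subseteq> V" using N.subset by simp
  have "subgroup V (add_monoid M)" by (rule V.subgroup_axioms)
  moreover have "subgroup N ((add_monoid M)\<lparr>carrier := V\<rparr>)"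
    using N.subgroup_axioms by simp
  ultimately have "subgroup N (add_monoid M)"
    by (metis M.add.incl_subgroup)
  moreover have "a \<odot>\<^bsub>M\<^esub> x \<in> N" if "a \<in> carrier R" "x \<in> N" for a x
    using N.smult_closed[OF that] by simp
  ultimately show "submodule N R M"
    by (intro submodule.intro submodule_axioms.intro)
qed

lemma isomorphic_modules_sym:
  assumes "left_module R M" "isomorphic_modules R M N"
  shows "isomorphic_modules R N M"
proof -
  interpret left_module R M by fact
  obtain h where h: "h \<in> left_module_hom R M N" "bij_betw h (carrier M) (carrier N)"
    using assms(2) by (auto simp: isomorphic_modules_def)
  let ?g = "inv_into (carrier M) h"
  have g: "?g y \<in> carrier M" "h (?g y) = y" if "y \<in> carrier N" for y
    using h(2) that by (auto simp: bij_betw_def inv_into_into f_inv_into_f)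
  have gI: "?g y = x" if "h x = y" "x \<in> carrier M" for x y
    using h(2) that by (auto simp: bij_betw_def)
  have "?g \<in> left_module_hom R N M"
    unfolding left_module_hom_def
  proof (intro CollectI conjI ballI funcsetI)
    fix x y assume "x \<in> carrier N" "y \<in> carrier N"
    then show "?g (x \<oplus>\<^bsub>N\<^esub> y) = ?g x \<oplus>\<^bsub>M\<^esub> ?g y"
      using h(1) g by (intro gI) (auto simp: left_module_hom_def)
  next
    fix r x assume "r \<in> carrier R" "x \<in> carrier N"
    then show "?g (r \<odot>\<^bsub>N\<^esub> x) = r \<odot>\<^bsub>M\<^esub> ?g x"
      using h(1) g by (intro gI) (auto simp: left_module_hom_def smult_closed)
  qed (use g in auto)
  moreover have "bij_betw ?g (carrier N) (carrier M)"
    by (rule bij_betw_inv_into[OF h(2)])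
  ultimately show ?thesis by (auto simp: isomorphic_modules_def)
qed

section \<open>Coordinates of the operators\<close>

lemma lookup_linear_extension:
  "Poly_Mapping.lookup (linear_extension f x) j =
    (\<Sum>i\<in>Poly_Mapping.keys x. Poly_Mapping.lookup x i * Poly_Mapping.lookup (f i) j)"
  by (simp add: linear_extension_def lookup_sum lookup_scale)

text \<open>For matrix rows whose only possibly nonzero entry is in column \<open>k\<close>.\<close>

lemma lookup_linear_extension_eq:
  assumes "\<And>i. i \<noteq> k \<Longrightarrow> Poly_Mapping.lookup (f i) j = 0"
  shows "Poly_Mapping.lookup (linear_extension f x) j =
    Poly_Mapping.lookup x k * Poly_Mapping.lookup (f k) j"
proof -
  have "Poly_Mapping.lookup (linear_extension f x) j =
      (\<Sum>i\<in>Poly_Mapping.keys x.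
        if i = k then Poly_Mapping.lookup x k * Poly_Mapping.lookup (f k) j else 0)"
    unfolding lookup_linear_extension by (rule sum.cong) (auto simp: assms)
  then show ?thesis by (simp add: in_keys_iff)
qed

lemma sum_scale_single:
  "(\<Sum>i\<in>Poly_Mapping.keys x. scale (Poly_Mapping.lookup x i) (Poly_Mapping.single i 1)) = x"
  by (rule poly_mapping_eqI)
    (simp add: lookup_sum lookup_scale lookup_single when_def in_keys_iff if_distrib cong: if_cong)

lemmas lookup_vec = v_vec_def w_vec_def lookup_single lookup_scale lookup_add lookup_minus when_def

lemma lookup_a_op_v:
  "Poly_Mapping.lookup (a_op q x) (Inl n) =
    (q ^ Suc n - 1) / (q - 1) * Poly_Mapping.lookup x (Inl (Suc n))"
proof -
  let ?f = "\<lambda>Inl n \<Rightarrow> (if n = 0 then 0 else scale ((q ^ n - 1) / (q - 1)) (v_vec (n - 1)))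
     | Inr n \<Rightarrow> scale (q ^ n) (w_vec n + w_vec (n + 1))"
  have "Poly_Mapping.lookup (?f i) (Inl n) = 0" if "i \<noteq> Inl (Suc n)" for i
  proof (cases i)
    case (Inl k)
    with that show ?thesis by (cases k) (simp_all add: lookup_vec)
  qed (simp add: lookup_vec)
  from lookup_linear_extension_eq[of "Inl (Suc n)" ?f, OF this] show ?thesis
    unfolding a_op_def by (simp add: lookup_vec)
qed

text \<open>Row \<open>Inl 0\<close> is excluded because every \<open>w_vec n\<close> contributes
  \<open>(- 1) ^ n\<close> to it.\<close>

lemma lookup_b_op_v_Suc:
  "Poly_Mapping.lookup (b_op q x) (Inl (Suc n)) = Poly_Mapping.lookup x (Inl n)"
  unfolding b_op_def
  by (subst lookup_linear_extension_eq[where k = "Inl n"])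
    (auto simp: lookup_vec split: sum.splits)

text \<open>The \<open>\<lambda>\<^sub>n\<close> of the overview, by which \<open>b\<close> acts on
  the class of \<open>w_vec n\<close> modulo \<open>V\<close>.\<close>

definition b_eigenvalue :: "'k::field \<Rightarrow> nat \<Rightarrow> 'k" where
  "b_eigenvalue q n = q powi (- int n) / (1 - q)"

lemma lookup_b_op_w:
  "Poly_Mapping.lookup (b_op q x) (Inr n) = b_eigenvalue q n * Poly_Mapping.lookup x (Inr n)"
  unfolding b_op_def b_eigenvalue_def
  by (subst lookup_linear_extension_eq[where k = "Inr n"])
    (auto simp: lookup_vec split: sum.splits)

text \<open>Up to a scalar, \<open>a\<close> sends the k-th \<open>w\<close> to the sum of the k-th
  and the next one, so it never lowers an index. This makes the chain in
  \<open>not_artinian_M\<close> invariant.\<close>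

lemma lookup_a_op_w_eq_0:
  assumes "\<And>i. i < m \<Longrightarrow> Poly_Mapping.lookup x (Inr i) = 0" "n < m"
  shows "Poly_Mapping.lookup (a_op q x) (Inr n) = 0"
  unfolding a_op_def lookup_linear_extension
proof (rule sum.neutral, rule ballI)
  fix i assume i: "i \<in> Poly_Mapping.keys x"
  show "Poly_Mapping.lookup x i * Poly_Mapping.lookup (case i of
      Inl n \<Rightarrow> if n = 0 then 0 else scale ((q ^ n - 1) / (q - 1)) (v_vec (n - 1))
    | Inr n \<Rightarrow> scale (q ^ n) (w_vec n + w_vec (n + 1))) (Inr n) = 0"
  proof (cases i)
    case (Inl k)
    then show ?thesis by (simp add: lookup_vec)
  next
    case (Inr k)
    then have "m \<le> k" using i assms(1)[of k] by (auto simp: in_keys_iff not_less[symmetric])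
    with Inr assms(2) show ?thesis by (simp add: lookup_vec)
  qed
qed

lemma weyl_V_iff: "x \<in> weyl_V \<longleftrightarrow> (\<forall>n. Poly_Mapping.lookup x (Inr n) = 0)"
proof
  have "scale.subspace {x :: 'a M_space. \<forall>n. Poly_Mapping.lookup x (Inr n) = 0}"
    by (auto simp: scale.subspace_def lookup_add lookup_scale)
  moreover have "range v_vec \<subseteq> {x :: 'a M_space. \<forall>n. Poly_Mapping.lookup x (Inr n) = 0}"
    by (auto simp: lookup_vec)
  ultimately have "weyl_V \<subseteq> {x :: 'a M_space. \<forall>n. Poly_Mapping.lookup x (Inr n) = 0}"
    unfolding weyl_V_def by (intro scale.span_minimal)
  then show "x \<in> weyl_V \<Longrightarrow> \<forall>n. Poly_Mapping.lookup x (Inr n) = 0" by blast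
next
  assume x: "\<forall>n. Poly_Mapping.lookup x (Inr n) = 0"
  have "scale (Poly_Mapping.lookup x i) (Poly_Mapping.single i 1) \<in> weyl_V"
    if "i \<in> Poly_Mapping.keys x" for i
  proof -
    obtain n where "i = Inl n" using x \<open>i \<in> _\<close> by (cases i) (auto simp: in_keys_iff)
    then have "Poly_Mapping.single i 1 \<in> range v_vec" by (auto simp: v_vec_def)
    then show ?thesis unfolding weyl_V_def by (intro scale.span_scale scale.span_base)
  qed
  then have "(\<Sum>i\<in>Poly_Mapping.keys x. scale (Poly_Mapping.lookup x i) (Poly_Mapping.single i 1)) \<in> weyl_V"
    unfolding weyl_V_def by (rule scale.span_sum)
  then show "x \<in> weyl_V" by (simp only: sum_scale_single)
qed

section \<open>Invariant subspaces\<close>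

text \<open>A description of submodules of \<open>M\<close> free of cosets; it also serves for
  preimages of submodules of \<open>W\<close>.\<close>

definition invariant_subspace :: "'k::field \<Rightarrow> 'k M_space set \<Rightarrow> bool" where
  "invariant_subspace q N \<longleftrightarrow>
    scale.subspace N \<and> (\<forall>x\<in>N. a_op q x \<in> N) \<and> (\<forall>x\<in>N. b_op q x \<in> N)"

lemma invariant_subspace_free_action:
  assumes N: "invariant_subspace q N" and x: "x \<in> N"
  shows "free_action q f x \<in> N"
proof -
  have "foldr (gen_op q) u x \<in> N" for u
  proof (induction u)
    case (Cons g u)
    then show ?case using N by (cases g) (auto simp: gen_op_def invariant_subspace_def)
  qed (simp add: x)
  then show ?thesis
    using N unfolding free_action_def linear_extension_def invariant_subspace_def
    by (intro scale.subspace_sum scale.subspace_scale) auto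
qed

section \<open>Submodules of \<open>M\<close> and the eigenvalues of \<open>b\<close> modulo
  \<open>V\<close>\<close>

locale generic_q =
  fixes q :: "'k::field"
  assumes q_nonzero: "q \<noteq> 0"
    and q_pow: "n > 0 \<Longrightarrow> q ^ n \<noteq> 1"
begin

lemma q_neq_1: "q \<noteq> 1"
  using q_pow[of 1] by simp

abbreviation "C \<equiv> quantized_weyl_algebra q"
abbreviation "M \<equiv> weyl_M q"
abbreviation "W \<equiv> weyl_W q"
abbreviation "coset \<equiv> \<lambda>f. weyl_ideal q +>\<^bsub>free_algebra\<^esub> f"
abbreviation "proj \<equiv> \<lambda>x. weyl_V +>\<^bsub>M\<^esub> x"

sublocale M: left_module C M
  by (rule left_module_weyl_M[OF q_nonzero q_neq_1])

lemmas smult_M = smult_weyl_M[OF q_nonzero q_neq_1]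

lemma coset_in_C [simp]: "coset f \<in> carrier C"
  by (auto simp: weyl_algebra_cosets)

lemma a_inv_M: "\<ominus>\<^bsub>M\<^esub> x = - x"
  by (rule M.minus_equality) (simp_all add: weyl_M_def)

text \<open>Scalars of K act through the cosets of \<open>scale c 1\<close>, and \<open>a\<close>,
  \<open>b\<close> through those of the generators. Conversely every coset acts as a linear
  combination of words in \<open>a\<close> and \<open>b\<close>.\<close>

lemma submodule_M_iff: "submodule N C M \<longleftrightarrow> invariant_subspace q N"
proof
  assume "submodule N C M"
  then interpret N: submodule N C M .
  have act: "free_action q f x \<in> N" if "x \<in> N" for f x
    using N.smult_closed[OF coset_in_C that] by (simp add: smult_M)
  have "scale c x \<in> N" if "x \<in> N" for c x
    using act[OF that, of "scale c 1"] by (simp add: free_action_scale_left free_action_one)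
  moreover have "0 \<in> N" using N.one_closed by (simp add: weyl_M_def)
  moreover have "x + y \<in> N" if "x \<in> N" "y \<in> N" for x y
    using N.m_closed[OF that] by (simp add: weyl_M_def)
  ultimately show "invariant_subspace q N"
    using act[of _ "generator Gen_a"] act[of _ "generator Gen_b"]
    by (auto simp: invariant_subspace_def scale.subspace_def free_action_generator gen_op_def)
next
  assume N: "invariant_subspace q N"
  then have sub: "scale.subspace N" by (simp add: invariant_subspace_def)
  have "subgroup N (add_monoid M)"
  proof (rule M.add.subgroupI)
    show "N \<noteq> {}" using scale.subspace_0[OF sub] by auto
    show "\<ominus>\<^bsub>M\<^esub> x \<in> N" if "x \<in> N" for x
      using scale.subspace_neg[OF sub that] by (simp add: a_inv_M)
    show "x \<oplus>\<^bsub>M\<^esub> y \<in> N" if "x \<in> N" "y \<in> N" for x y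
      using scale.subspace_add[OF sub that] by (simp add: weyl_M_def)
  qed (simp add: weyl_M_def)
  then show "submodule N C M"
    by (intro submodule.intro submodule_axioms.intro)
      (auto simp: weyl_algebra_cosets smult_M invariant_subspace_free_action[OF N])
qed

lemma submodule_V: "submodule weyl_V C M"
  by (rule submodule_weyl_V[OF q_nonzero q_neq_1])

text \<open>Equal eigenvalues for \<open>m \<le> n\<close> give \<open>q ^ (n - m) = 1\<close>,
  which forces \<open>m = n\<close> since \<open>q\<close> is not a root of unity.\<close>

lemma b_eigenvalue_inj: "b_eigenvalue q m = b_eigenvalue q n \<longleftrightarrow> m = n"
proof -
  have "m = n" if "m \<le> n" "b_eigenvalue q m = b_eigenvalue q n" for m n
  proof -
    have "q ^ m = q ^ n"
      using that q_neq_1 q_nonzero by (simp add: b_eigenvalue_def power_int_minus)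
    also have "\<dots> = q ^ m * q ^ (n - m)" using that by (simp flip: power_add)
    finally have "q ^ (n - m) = 1" using q_nonzero by simp
    then show ?thesis using q_pow[of "n - m"] that by fastforce
  qed
  then show ?thesis by (metis nat_le_linear)
qed

lemma b_eigenvalue_nonzero: "b_eigenvalue q n \<noteq> 0"
  using q_neq_1 q_nonzero by (simp add: b_eigenvalue_def)

lemma invariant_b_minus_eigenvalue:
  assumes "invariant_subspace q N" "x \<in> N"
  shows "b_op q x - scale (b_eigenvalue q m) x \<in> N"
  using assms by (auto simp: invariant_subspace_def intro!: scale.subspace_diff scale.subspace_scale)

text \<open>Thus \<open>b - \<lambda>\<^sub>m\<close> kills the coordinate at \<open>w_vec m\<close>
  and, by \<open>b_eigenvalue_inj\<close>, multiplies each other \<open>w\<close> coordinate by a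
  nonzero factor.\<close>

lemma lookup_b_minus_eigenvalue:
  "Poly_Mapping.lookup (b_op q x - scale (b_eigenvalue q m) x) (Inr n) =
    (b_eigenvalue q n - b_eigenvalue q m) * Poly_Mapping.lookup x (Inr n)"
  by (simp add: lookup_minus lookup_b_op_w lookup_scale algebra_simps)

text \<open>Modulo \<open>V\<close>, the \<open>w\<^sub>n\<close> are eigenvectors of \<open>b\<close> for distinct eigenvalues, so the unwanted
  components of \<open>x\<close> can be removed one at a time.\<close>

lemma isolate_w:
  assumes N: "invariant_subspace q N"
    and "x \<in> N" "Poly_Mapping.lookup x (Inr n) \<noteq> 0"
  shows "\<exists>u\<in>weyl_V. w_vec n + u \<in> N"
  using assms(2,3)
proof (induction "card {m. Poly_Mapping.lookup x (Inr m) \<noteq> 0}" arbitrary: x rule: less_induct)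
  case less
  let ?S = "\<lambda>x :: 'k M_space. {m. Poly_Mapping.lookup x (Inr m) \<noteq> 0}"
  have "finite (Inr -` Poly_Mapping.keys x)"
    by (rule finite_vimageI) auto
  also have "Inr -` Poly_Mapping.keys x = ?S x" by (auto simp: in_keys_iff)
  finally have fin: "finite (?S x)" .
  show ?case
  proof (cases "\<exists>m. m \<noteq> n \<and> m \<in> ?S x")
    case True
    then obtain m where m: "m \<noteq> n" "m \<in> ?S x" by blast
    let ?y = "b_op q x - scale (b_eigenvalue q m) x"
    have "?S ?y \<subset> ?S x"
      using m by (auto simp: lookup_b_minus_eigenvalue)
    then have "card (?S ?y) < card (?S x)" by (rule psubset_card_mono[OF fin])
    moreover have "?y \<in> N" by (rule invariant_b_minus_eigenvalue[OF N less.prems(1)])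
    moreover have "Poly_Mapping.lookup ?y (Inr n) \<noteq> 0"
      using m less.prems by (auto simp: lookup_b_minus_eigenvalue b_eigenvalue_inj)
    ultimately show ?thesis by (rule less.hyps)
  next
    case False
    \<comment> \<open>Only the coordinate at \<open>n\<close> survives modulo \<open>V\<close>;
      rescaling makes it 1.\<close>
    let ?y = "scale (1 / Poly_Mapping.lookup x (Inr n)) x"
    have "?y - w_vec n \<in> weyl_V"
      using False less.prems by (auto simp: weyl_V_iff lookup_vec)
    moreover have "w_vec n + (?y - w_vec n) \<in> N"
      using N less.prems by (auto simp: invariant_subspace_def intro: scale.subspace_scale)
    ultimately show ?thesis by blast
  qed
qed

section \<open>Simplicity of \<open>V\<close>\<close>

text \<open>Here \<open>n\<close> is the degree of \<open>x\<close>. Applying \<open>a\<close>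
  lowers it by exactly one, as the factor \<open>(q ^ Suc n - 1) / (q - 1)\<close> is nonzero; in
  degree 0 a rescaling gives \<open>v_vec 0\<close>.\<close>

lemma v0_in_invariant_subspace:
  assumes N: "invariant_subspace q N" "N \<subseteq> weyl_V"
    and "x \<in> N" "Poly_Mapping.lookup x (Inl n) \<noteq> 0" "\<And>k. k > n \<Longrightarrow> Poly_Mapping.lookup x (Inl k) = 0"
  shows "v_vec 0 \<in> N"
  using assms(3-)
proof (induction n arbitrary: x)
  case 0
  have "scale (1 / Poly_Mapping.lookup x (Inl 0)) x = v_vec 0"
  proof (rule poly_mapping_eqI)
    fix i
    show "Poly_Mapping.lookup (scale (1 / Poly_Mapping.lookup x (Inl 0)) x) i = Poly_Mapping.lookup (v_vec 0) i"
      using 0 N(2) by (cases i) (auto simp: lookup_vec weyl_V_iff)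
  qed
  moreover have "scale (1 / Poly_Mapping.lookup x (Inl 0)) x \<in> N"
    using N 0 by (auto simp: invariant_subspace_def intro: scale.subspace_scale)
  ultimately show ?case by simp
next
  case (Suc n)
  show ?case
  proof (rule Suc.IH)
    show "a_op q x \<in> N" using N Suc.prems by (simp add: invariant_subspace_def)
    show "Poly_Mapping.lookup (a_op q x) (Inl n) \<noteq> 0"
      using Suc.prems q_pow[of "Suc n"] q_neq_1 by (simp add: lookup_a_op_v del: power_Suc)
    show "Poly_Mapping.lookup (a_op q x) (Inl k) = 0" if "k > n" for k
      using Suc.prems(3)[of "Suc k"] that by (simp add: lookup_a_op_v)
  qed
qed

lemma invariant_subspace_of_V:
  assumes N: "invariant_subspace q N" "N \<subseteq> weyl_V" and "N \<noteq> {0}"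
  shows "N = weyl_V"
proof -
  have sub: "scale.subspace N" using N by (simp add: invariant_subspace_def)
  obtain x where x: "x \<in> N" "x \<noteq> 0"
    using \<open>N \<noteq> {0}\<close> scale.subspace_0[OF sub] by blast
  let ?S = "{n. Poly_Mapping.lookup x (Inl n) \<noteq> 0}"
  have "finite (Inl -` Poly_Mapping.keys x)"
    by (rule finite_vimageI) auto
  also have "Inl -` Poly_Mapping.keys x = ?S" by (auto simp: in_keys_iff)
  finally have fin: "finite ?S" .
  have "?S \<noteq> {}"
  proof
    assume "?S = {}"
    have "Poly_Mapping.lookup x i = 0" for i
      using \<open>?S = {}\<close> x(1) N(2) by (cases i) (auto simp: weyl_V_iff)
    with x(2) show False by (auto intro: poly_mapping_eqI)
  qed
  \<comment> \<open>The degree of \<open>x\<close> is the maximum of its finite support; afterwards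
    \<open>b\<close> produces every \<open>v_vec n\<close> from \<open>v_vec 0\<close>.\<close>
  have "v_vec 0 \<in> N"
  proof (rule v0_in_invariant_subspace[OF N x(1)])
    show "Poly_Mapping.lookup x (Inl (Max ?S)) \<noteq> 0"
      using Max_in[OF fin \<open>?S \<noteq> {}\<close>] by simp
    show "Poly_Mapping.lookup x (Inl k) = 0" if "k > Max ?S" for k
      using Max_ge[OF fin, of k] that by force
  qed
  then have "v_vec n \<in> N" for n
  proof (induction n)
    case (Suc n)
    then have "b_op q (v_vec n) \<in> N" using N by (simp add: invariant_subspace_def)
    then show ?case by (simp add: b_op_v)
  qed
  then have "weyl_V \<subseteq> N"
    unfolding weyl_V_def by (intro scale.span_minimal sub) auto
  with N(2) show ?thesis by blast
qed

lemma simple_V: "simple_module C (M\<lparr>carrier := weyl_V\<rparr>)"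
  unfolding simple_module_def
proof (intro conjI allI impI)
  show "left_module C (M\<lparr>carrier := weyl_V\<rparr>)"
    by (intro left_module_submodule submodule_V) (rule M.left_module_axioms)
  have "v_vec 0 \<in> (weyl_V :: 'k M_space set)" by (simp add: weyl_V_iff lookup_vec)
  moreover have "Poly_Mapping.lookup (v_vec 0 :: 'k M_space) (Inl 0) \<noteq> 0" by (simp add: lookup_vec)
  then have "v_vec 0 \<noteq> (0 :: 'k M_space)" by force
  ultimately show "carrier (M\<lparr>carrier := weyl_V\<rparr>) \<noteq> {\<zero>\<^bsub>M\<lparr>carrier := weyl_V\<rparr>\<^esub>}"
    by (auto simp: weyl_M_def)
next
  fix N assume "submodule N C (M\<lparr>carrier := weyl_V\<rparr>)"
  note N = submodule_of_submodule[OF M.left_module_axioms submodule_V this]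
  show "N = {\<zero>\<^bsub>M\<lparr>carrier := weyl_V\<rparr>\<^esub>} \<or> N = carrier (M\<lparr>carrier := weyl_V\<rparr>)"
    using invariant_subspace_of_V[of N] N unfolding submodule_M_iff by (auto simp: weyl_M_def)
qed

section \<open>\<open>M\<close> is not Artinian and is essential over \<open>V\<close>\<close>

text \<open>The subspaces spanned by \<open>V\<close> and the \<open>w_vec n\<close> with
  \<open>n \<ge> m\<close> form a descending chain in \<open>m\<close>, strict because
  \<open>w_vec n\<close> is lost between steps \<open>n\<close> and \<open>Suc n\<close>.\<close>

lemma not_artinian_M: "\<not> artinian_module C M"
proof
  assume artinian: "artinian_module C M"
  define N :: "nat \<Rightarrow> 'k M_space set"
    where "N = (\<lambda>m. {x. \<forall>n<m. Poly_Mapping.lookup x (Inr n) = 0})"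
  have "scale.subspace (N m)" for m
    by (auto simp: N_def scale.subspace_def lookup_add lookup_scale)
  then have "submodule (N m) C M" for m
    by (auto simp: submodule_M_iff invariant_subspace_def N_def lookup_b_op_w
        intro: lookup_a_op_w_eq_0)
  moreover have "decseq N" by (auto simp: N_def decseq_def)
  ultimately obtain n where "N (Suc n) = N n"
    using artinian unfolding artinian_module_def by (metis le_SucI order_refl)
  moreover have "w_vec n \<in> N n" "w_vec n \<notin> N (Suc n)"
    by (auto simp: N_def lookup_vec)
  ultimately show False by blast
qed

text \<open>If \<open>b u = \<lambda> u - c v\<^sub>0\<close> with \<open>c \<noteq> 0\<close>, all coordinates of \<open>u\<close> would be nonzero.\<close>

lemma b_minus_eigenvalue_w_neq_0:
  assumes u: "u \<in> weyl_V"
  shows "b_op q (w_vec n + u) - scale (b_eigenvalue q n) (w_vec n + u) \<noteq> 0" (is "?y \<noteq> 0")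
proof
  interpret b: Vector_Spaces.linear scale scale "b_op q" by (rule linear_b_op)
  \<comment> \<open>The multiples of \<open>w_vec n\<close> cancel, leaving the
    \<open>v_vec 0\<close> term of \<open>b_op_w\<close>.\<close>
  have y: "?y = scale ((- 1) ^ n) (v_vec 0) + (b_op q u - scale (b_eigenvalue q n) u)"
    by (simp add: b.add b_op_w b_eigenvalue_def scale.scale_right_distrib)
  assume y0: "?y = 0"
  \<comment> \<open>On \<open>V\<close> the operator \<open>b\<close> raises every index, and
    \<open>u\<close> has no \<open>w\<close> coordinates that could contribute to
    \<open>v_vec 0\<close>.\<close>
  have bu: "Poly_Mapping.lookup (b_op q u) (Inl 0) = 0"
    using u unfolding b_op_def lookup_linear_extension
    by (intro sum.neutral) (auto simp: weyl_V_iff lookup_vec split: sum.splits)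
  have nz: "Poly_Mapping.lookup u (Inl k) \<noteq> 0" for k
  proof (induction k)
    case 0
    have "Poly_Mapping.lookup ?y (Inl 0) = 0" by (simp add: y0)
    then have "(- 1) ^ n - b_eigenvalue q n * Poly_Mapping.lookup u (Inl 0) = 0"
      unfolding y by (simp add: lookup_vec bu)
    then show ?case by auto
  next
    case (Suc k)
    have "Poly_Mapping.lookup ?y (Inl (Suc k)) = 0" by (simp add: y0)
    then have "Poly_Mapping.lookup u (Inl k) - b_eigenvalue q n * Poly_Mapping.lookup u (Inl (Suc k)) = 0"
      unfolding y by (simp add: lookup_vec lookup_b_op_v_Suc)
    with Suc show ?case by auto
  qed
  have "finite (Inl -` Poly_Mapping.keys u)"
    by (rule finite_vimageI) auto
  moreover have "Inl -` Poly_Mapping.keys u = UNIV" using nz by (auto simp: in_keys_iff)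
  ultimately show False by simp
qed

lemma essential_V: "essential_extension C M weyl_V"
  unfolding essential_extension_def
proof (intro conjI allI impI)
  fix N assume N: "submodule N C M \<and> N \<noteq> {\<zero>\<^bsub>M\<^esub>}"
  then have inv: "invariant_subspace q N" by (simp add: submodule_M_iff)
  then have "0 \<in> N" by (simp add: invariant_subspace_def scale.subspace_0)
  with N have nz: "N \<noteq> {0}" by (simp add: weyl_M_def)
  have "\<exists>x\<in>N \<inter> weyl_V. x \<noteq> 0"
  proof (cases "N \<subseteq> weyl_V")
    case True
    with nz \<open>0 \<in> N\<close> show ?thesis by blast
  next
    case False
    then obtain x n where "x \<in> N" "Poly_Mapping.lookup x (Inr n) \<noteq> 0"
      unfolding weyl_V_iff subset_iff by blast
    then obtain u where u: "u \<in> weyl_V" "w_vec n + u \<in> N"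
      using isolate_w[OF inv] by blast
    let ?y = "b_op q (w_vec n + u) - scale (b_eigenvalue q n) (w_vec n + u)"
    have "?y \<in> N" by (rule invariant_b_minus_eigenvalue[OF inv u(2)])
    moreover have "?y \<in> weyl_V"
      using u(1) unfolding weyl_V_iff lookup_b_minus_eigenvalue by (simp add: lookup_vec)
    ultimately show ?thesis using b_minus_eigenvalue_w_neq_0[OF u(1)] by blast
  qed
  then show "N \<inter> weyl_V \<noteq> {\<zero>\<^bsub>M\<^esub>}" by (auto simp: weyl_M_def)
qed (rule M.left_module_axioms submodule_V)+

section \<open>Submodules of \<open>W\<close>\<close>

lemma proj_eq: "proj x = (\<lambda>v. v + x) ` weyl_V"
  by (auto simp: a_r_coset_def r_coset_def weyl_M_def)

lemma proj_self: "x \<in> proj x"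
  by (auto simp: proj_eq weyl_V_iff intro!: image_eqI[of _ _ 0])

lemma proj_eq_iff: "proj x = proj y \<longleftrightarrow> x - y \<in> weyl_V"
proof
  assume "proj x = proj y"
  then have "x \<in> proj y" using proj_self[of x] by simp
  then obtain v where "v \<in> weyl_V" "x = v + y" by (auto simp: proj_eq)
  then show "x - y \<in> weyl_V" by simp
next
  assume *: "x - y \<in> weyl_V"
  have "v + x \<in> proj y" "v + y \<in> proj x" if "v \<in> weyl_V" for v
  proof -
    have "v + (x - y) \<in> weyl_V" "v + (y - x) \<in> weyl_V"
      using * that by (simp_all add: weyl_V_iff lookup_vec)
    then show "v + x \<in> proj y" "v + y \<in> proj x"
      unfolding proj_eq by (force intro: image_eqI[of _ _ "v + (x - y)"] image_eqI[of _ _ "v + (y - x)"])+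
  qed
  then show "proj x = proj y" by (auto simp: proj_eq)
qed

lemma carrier_W: "carrier W = range proj"
  by (auto simp: weyl_W_def quotient_module_def A_RCOSETS_def RCOSETS_def a_r_coset_def weyl_M_def)

lemma zero_W: "\<zero>\<^bsub>W\<^esub> = proj 0"
  by (simp add: weyl_W_def quotient_module_def proj_eq)

lemma add_W: "proj x \<oplus>\<^bsub>W\<^esub> proj y = proj (x + y)"
proof -
  interpret V: submodule weyl_V C M by (rule submodule_V)
  interpret V: abelian_subgroup weyl_V M
    by (rule abelian_subgroupI3)
      (use V.subgroup_axioms M.abelian_group_axioms in \<open>auto intro: additive_subgroup.intro\<close>)
  have "proj x <+>\<^bsub>M\<^esub> proj y = proj (x \<oplus>\<^bsub>M\<^esub> y)"
    by (rule V.a_rcos_sum) (simp_all add: weyl_M_def)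
  then show ?thesis by (simp add: weyl_W_def quotient_module_def) (simp add: weyl_M_def)
qed

lemma smult_W: "coset f \<odot>\<^bsub>W\<^esub> proj x = proj (free_action q f x)"
proof -
  have "proj (free_action q f y) = proj (free_action q f x)" if y: "y \<in> proj x" for y
  proof -
    obtain v where v: "v \<in> weyl_V" "y = v + x"
      using y by (auto simp: proj_eq)
    interpret F: Vector_Spaces.linear scale scale "free_action q f"
      by (rule linear_free_action_right)
    show ?thesis
      using free_action_weyl_V[OF v(1)] by (simp add: proj_eq_iff v(2) F.add)
  qed
  \<comment> \<open>The union defining the quotient action runs over equal cosets, since
    \<open>V\<close> is stable under the action.\<close>
  with proj_self have "(\<Union>y\<in>proj x. proj (free_action q f y)) = proj (free_action q f x)"
    by blast
  then show ?thesis
    by (simp add: weyl_W_def quotient_module_def smult_M)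
qed

text \<open>Pulling submodules of \<open>W\<close> back to \<open>M\<close> makes
  \<open>isolate_w\<close> available; \<open>submodule_W_eq\<close> recovers the submodule.\<close>

definition preimage :: "'k M_space set set \<Rightarrow> 'k M_space set" where
  "preimage N = {x. proj x \<in> N}"

lemma submodule_W_eq:
  assumes "submodule N C W"
  shows "N = proj ` preimage N"
proof -
  interpret submodule N C W by fact
  show ?thesis
    using subset unfolding preimage_def by (auto simp: carrier_W)
qed

lemma invariant_preimage:
  assumes "submodule N C W"
  shows "invariant_subspace q (preimage N)" "weyl_V \<subseteq> preimage N"
proof -
  interpret N: submodule N C W by fact
  have zero: "proj 0 \<in> N" using N.one_closed by (simp add: zero_W)
  show "weyl_V \<subseteq> preimage N"
  proof
    fix x :: "'k M_space" assume "x \<in> weyl_V"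
    then have "proj x = proj 0" by (simp add: proj_eq_iff)
    with zero show "x \<in> preimage N" by (simp add: preimage_def)
  qed
  have act: "free_action q f x \<in> preimage N" if "x \<in> preimage N" for f x
    using N.smult_closed[OF coset_in_C, of "proj x" f] that by (simp add: smult_W preimage_def)
  have "x + y \<in> preimage N" if "x \<in> preimage N" "y \<in> preimage N" for x y
    using N.m_closed[of "proj x" "proj y"] that by (simp add: add_W preimage_def)
  moreover have "scale c x \<in> preimage N" if "x \<in> preimage N" for c x
    using act[OF that, of "scale c 1"] by (simp add: free_action_scale_left free_action_one)
  ultimately show "invariant_subspace q (preimage N)"
    using act[of _ "generator Gen_a"] act[of _ "generator Gen_b"] zero
    by (auto simp: invariant_subspace_def scale.subspace_def free_action_generator gen_op_def preimage_def)
qed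

context
  fixes P assumes P: "invariant_subspace q P" "weyl_V \<subseteq> P"
begin

text \<open>As \<open>P\<close> contains \<open>V\<close>, the error term \<open>u\<close> of
  \<open>isolate_w\<close> can be subtracted inside \<open>P\<close>.\<close>

lemma w_in_if_coordinate:
  assumes "x \<in> P" "Poly_Mapping.lookup x (Inr n) \<noteq> 0"
  shows "w_vec n \<in> P"
proof -
  obtain u where "u \<in> weyl_V" "w_vec n + u \<in> P"
    using isolate_w[OF P(1) assms] by blast
  then have "w_vec n + u - u \<in> P"
    using P by (intro scale.subspace_diff) (auto simp: invariant_subspace_def)
  then show ?thesis by simp
qed

text \<open>The vector \<open>a_op q (w_vec n)\<close> has coefficient \<open>q ^ n\<close>, hence
  nonzero, at the next \<open>w\<close>, which can then be isolated.\<close>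

lemma w_up:
  assumes "w_vec m \<in> P" "m \<le> n"
  shows "w_vec n \<in> P"
  using assms(2)
proof (induction n rule: dec_induct)
  case (step n)
  have "a_op q (w_vec n) \<in> P"
    using P step.IH by (simp add: invariant_subspace_def)
  moreover have "Poly_Mapping.lookup (a_op q (w_vec n)) (Inr (Suc n)) \<noteq> 0"
    unfolding a_op_w by (simp add: lookup_vec q_nonzero)
  ultimately show ?case by (rule w_in_if_coordinate)
qed (rule assms(1))

text \<open>Together with \<open>w_in_if_coordinate\<close> this shows that \<open>P\<close> is
  determined by the indices of the \<open>w\<close> vectors it contains.\<close>

lemma mem_if_w:
  assumes "\<And>n. Poly_Mapping.lookup x (Inr n) \<noteq> 0 \<Longrightarrow> w_vec n \<in> P"
  shows "x \<in> P"
proof -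
  have "scale (Poly_Mapping.lookup x i) (Poly_Mapping.single i 1) \<in> P"
    if "i \<in> Poly_Mapping.keys x" for i
  proof -
    have "Poly_Mapping.single i 1 \<in> P"
    proof (cases i)
      case (Inl n)
      then have "Poly_Mapping.single i 1 \<in> weyl_V" by (simp add: weyl_V_iff lookup_vec)
      with P(2) show ?thesis by blast
    next
      case (Inr n)
      then show ?thesis using assms[of n] that by (simp add: in_keys_iff w_vec_def)
    qed
    then show ?thesis using P(1) by (simp add: invariant_subspace_def scale.subspace_scale)
  qed
  then have "(\<Sum>i\<in>Poly_Mapping.keys x. scale (Poly_Mapping.lookup x i) (Poly_Mapping.single i 1)) \<in> P"
    using P(1) by (intro scale.subspace_sum) (auto simp: invariant_subspace_def)
  then show "x \<in> P" by (simp only: sum_scale_single)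
qed

end

lemma preimage_subset_iff:
  assumes "submodule N\<^sub>1 C W" "submodule N\<^sub>2 C W"
  shows "N\<^sub>1 \<subseteq> N\<^sub>2 \<longleftrightarrow> {n. w_vec n \<in> preimage N\<^sub>1} \<subseteq> {n. w_vec n \<in> preimage N\<^sub>2}"
proof
  assume "{n. w_vec n \<in> preimage N\<^sub>1} \<subseteq> {n. w_vec n \<in> preimage N\<^sub>2}"
  then have "preimage N\<^sub>1 \<subseteq> preimage N\<^sub>2"
    using mem_if_w[OF invariant_preimage[OF assms(2)]]
      w_in_if_coordinate[OF invariant_preimage[OF assms(1)]] by blast
  then show "N\<^sub>1 \<subseteq> N\<^sub>2"
    using submodule_W_eq[OF assms(1)] submodule_W_eq[OF assms(2)] by blast
qed (auto simp: preimage_def)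

text \<open>Two upward closed sets of naturals are comparable: given an index private to each, the
  larger one would lie in both sets.\<close>

lemma submodules_W_linear:
  assumes "submodule N\<^sub>1 C W" "submodule N\<^sub>2 C W"
  shows "N\<^sub>1 \<subseteq> N\<^sub>2 \<or> N\<^sub>2 \<subseteq> N\<^sub>1"
proof (rule ccontr)
  assume "\<not> ?thesis"
  then obtain m n where
    "w_vec m \<in> preimage N\<^sub>1" "w_vec m \<notin> preimage N\<^sub>2"
    "w_vec n \<in> preimage N\<^sub>2" "w_vec n \<notin> preimage N\<^sub>1"
    unfolding preimage_subset_iff[OF assms] preimage_subset_iff[OF assms(2,1)] by blast
  then show False
    using w_up[OF invariant_preimage[OF assms(1)]] w_up[OF invariant_preimage[OF assms(2)]]
    by (meson nat_le_linear)
qed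

text \<open>An isomorphism preserves the kernel of \<open>b - \<lambda>\<close>, where \<open>\<lambda>\<close> is the eigenvalue
  belonging to \<open>w\<^sub>m\<close>.\<close>

lemma w_in_isomorphic:
  assumes N: "submodule N\<^sub>1 C W" "submodule N\<^sub>2 C W"
    and iso: "isomorphic_modules C (W\<lparr>carrier := N\<^sub>1\<rparr>) (W\<lparr>carrier := N\<^sub>2\<rparr>)"
    and w: "w_vec m \<in> preimage N\<^sub>1"
  shows "w_vec m \<in> preimage N\<^sub>2"
proof -
  obtain h where h: "h \<in> left_module_hom C (W\<lparr>carrier := N\<^sub>1\<rparr>) (W\<lparr>carrier := N\<^sub>2\<rparr>)"
    and bij: "bij_betw h N\<^sub>1 N\<^sub>2"
    using iso by (auto simp: isomorphic_modules_def)
  have smult: "h (coset f \<odot>\<^bsub>W\<^esub> Y) = coset f \<odot>\<^bsub>W\<^esub> h Y" if "Y \<in> N\<^sub>1" for f Y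
    using h that by (simp add: left_module_hom_def)
  have w1: "proj (w_vec m) \<in> N\<^sub>1" using w by (simp add: preimage_def)
  then have "h (proj (w_vec m)) \<in> N\<^sub>2" using bij by (auto simp: bij_betw_def)
  then obtain y where y: "h (proj (w_vec m)) = proj y" "y \<in> preimage N\<^sub>2"
    using submodule_W_eq[OF N(2)] by blast
  interpret L: Vector_Spaces.linear scale scale "\<lambda>f. free_action q f x" for x
    by (rule linear_free_action_left)
  \<comment> \<open>Compatibility with the zero scalar already gives this.\<close>
  have h0: "h (proj 0) = proj 0"
    using smult[OF w1, of 0] by (simp add: smult_W L.zero y(1))
  \<comment> \<open>A representative of \<open>b - \<lambda>\<^sub>m\<close> in the free algebra;
    its coset is a scalar, so \<open>h\<close> commutes with it.\<close>
  define f where "f = generator Gen_b - scale (b_eigenvalue q m) 1"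
  have f: "free_action q f x = b_op q x - scale (b_eigenvalue q m) x" for x
    by (simp add: f_def L.diff L.scale free_action_generator free_action_one gen_op_def)
  have "proj (free_action q f (w_vec m)) = proj 0"
    unfolding f proj_eq_iff weyl_V_iff diff_zero lookup_b_minus_eigenvalue by (simp add: lookup_vec)
  then have "proj (free_action q f y) = proj 0"
    using smult[OF w1, of f] by (simp add: smult_W y(1) h0)
  then have ker: "(b_eigenvalue q n - b_eigenvalue q m) * Poly_Mapping.lookup y (Inr n) = 0" for n
    unfolding f proj_eq_iff weyl_V_iff diff_zero lookup_b_minus_eigenvalue by blast
  \<comment> \<open>By \<open>ker\<close>, only the coordinate at \<open>m\<close> can be nonzero.
    If it vanished too, \<open>y\<close> would lie in \<open>V\<close>, and injectivity of
    \<open>h\<close> would put \<open>w_vec m\<close> into \<open>V\<close>.\<close>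
  have "Poly_Mapping.lookup y (Inr m) \<noteq> 0"
  proof
    assume "Poly_Mapping.lookup y (Inr m) = 0"
    then have "Poly_Mapping.lookup y (Inr n) = 0" for n
      using ker[of n] by (cases "n = m") (auto simp: b_eigenvalue_inj)
    then have "h (proj (w_vec m)) = h (proj 0)"
      by (simp add: y(1) h0 proj_eq_iff weyl_V_iff)
    moreover have "proj 0 \<in> N\<^sub>1"
      using invariant_preimage(2)[OF N(1)] weyl_V_iff[of "0 :: 'k M_space"] unfolding preimage_def by auto
    ultimately have "proj (w_vec m) = proj 0"
      using bij w1 by (auto simp: bij_betw_def dest: inj_onD)
    then have "Poly_Mapping.lookup (w_vec m :: 'k M_space) (Inr m) = 0"
      by (auto simp: proj_eq_iff weyl_V_iff)
    then show False by (simp add: lookup_vec)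
  qed
  then show ?thesis
    by (rule w_in_if_coordinate[OF invariant_preimage[OF N(2)] y(2)])
qed

text \<open>The isomorphism and its inverse, fed to \<open>w_in_isomorphic\<close>, give the two
  inclusions between index sets.\<close>

lemma isomorphic_submodules_W_eq:
  assumes "submodule N\<^sub>1 C W" "submodule N\<^sub>2 C W"
    and iso: "isomorphic_modules C (W\<lparr>carrier := N\<^sub>1\<rparr>) (W\<lparr>carrier := N\<^sub>2\<rparr>)"
  shows "N\<^sub>1 = N\<^sub>2"
proof -
  have "left_module C (W\<lparr>carrier := N\<^sub>1\<rparr>)"
    by (intro left_module_submodule left_module_weyl_W assms q_nonzero q_neq_1)
  note iso' = isomorphic_modules_sym[OF this iso]
  have "N\<^sub>1 \<subseteq> N\<^sub>2" "N\<^sub>2 \<subseteq> N\<^sub>1"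
    unfolding preimage_subset_iff[OF assms(1,2)] preimage_subset_iff[OF assms(2,1)]
    using w_in_isomorphic[OF assms(1,2) iso] w_in_isomorphic[OF assms(2,1) iso'] by blast+
  then show ?thesis by blast
qed

end

theorem theorem4p2:
  fixes q :: "'k::field"
  assumes "q \<noteq> 0" and "\<forall>n::nat. n > 0 \<longrightarrow> q ^ n \<noteq> 1"
  shows "(simple_module (quantized_weyl_algebra q) ((weyl_M q)\<lparr>carrier := weyl_V\<rparr>) \<and>
          \<not> artinian_module (quantized_weyl_algebra q) (weyl_M q) \<and>
          essential_extension (quantized_weyl_algebra q) (weyl_M q) weyl_V) \<and>
         (\<forall>N\<^sub>1 N\<^sub>2. submodule N\<^sub>1 (quantized_weyl_algebra q) (weyl_W q) \<and>
                  submodule N\<^sub>2 (quantized_weyl_algebra q) (weyl_W q) \<longrightarrow>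
            (N\<^sub>1 \<subseteq> N\<^sub>2 \<or> N\<^sub>2 \<subseteq> N\<^sub>1) \<and>
            (N\<^sub>1 \<noteq> N\<^sub>2 \<longrightarrow>
              \<not> isomorphic_modules (quantized_weyl_algebra q)
                  ((weyl_W q)\<lparr>carrier := N\<^sub>1\<rparr>) ((weyl_W q)\<lparr>carrier := N\<^sub>2\<rparr>)))"
proof -
  interpret generic_q q
    using assms by unfold_locales auto
  show ?thesis
  proof (intro conjI allI impI notI)
    fix N\<^sub>1 N\<^sub>2
    assume N: "submodule N\<^sub>1 C W \<and> submodule N\<^sub>2 C W"
    then show "N\<^sub>1 \<subseteq> N\<^sub>2 \<or> N\<^sub>2 \<subseteq> N\<^sub>1" by (intro submodules_W_linear) simp_all
    assume "N\<^sub>1 \<noteq> N\<^sub>2" "isomorphic_modules C (W\<lparr>carrier := N\<^sub>1\<rparr>) (W\<lparr>carrier := N\<^sub>2\<rparr>)"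
    with N isomorphic_submodules_W_eq show False by blast
  qed (use simple_V not_artinian_M essential_V in blast)+
qed

end
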